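(* The set of discontinuities of the lower spectral radius $\underline{\varrho}\colon M_2(\mathbb{R})^2\to\mathbb{R}$ has Hausdorff dimension at least $7$.
   Context: $M_2(\mathbb{R})$ is the space of $2\times2$ real matrices, so $M_2(\mathbb{R})^2\cong\mathbb{R}^8$ with its usual Euclidean metric. For a pair $\mathsf{A}=(A_1,A_2)\in M_2(\mathbb{R})^2$ the lower spectral radius is $\underline{\varrho}(\mathsf{A})=\lim_{n\to\infty}\min\{\|A_{i_n}\cdots A_{i_1}\|^{1/n}\colon i_1,\dots,i_n\in\{1,2\}\}$ (independent of the choice of norm). *)

theory Defs
  imports "HOL-Analysis.Analysis"
begin

text \<open>
  The metric on \<^typ>\<open>real^2^2\<close> comes from the Frobenius norm and the metric of a product type
  is the Euclidean combination of the two component metrics.  Hence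
  \<^typ>\<open>(real^2^2) \<times> (real^2^2)\<close> is isometric to Euclidean space of dimension 8.
\<close>

type_synonym mat_pair = "(real^2^2) \<times> (real^2^2)"

definition pair_nth :: "mat_pair \<Rightarrow> nat \<Rightarrow> real^2^2" where
  "pair_nth A i = (if i = 1 then fst A else snd A)"

text \<open>The word \<open>[i\<^sub>1, \<dots>, i\<^sub>n]\<close> is sent to the product \<open>A i\<^sub>n ** \<dots> ** A i\<^sub>1\<close>.\<close>

fun word_product :: "mat_pair \<Rightarrow> nat list \<Rightarrow> real^2^2" where
  "word_product A [] = mat 1"
| "word_product A (i # w) = word_product A w ** pair_nth A i"

definition index_words :: "nat \<Rightarrow> nat list set" where
  "index_words n = {w. length w = n \<and> set w \<subseteq> {1, 2}}"

definition lower_spectral_radius :: "mat_pair \<Rightarrow> real" where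
  "lower_spectral_radius A =
     lim (\<lambda>n. Min ((\<lambda>w. root n (norm (word_product A w))) ` index_words n))"

text \<open>
  \<open>diam_power s U\<close> is the \<open>s\<close>-th power of the diameter of \<open>U\<close>, with the usual conventions that
  the empty set contributes 0 and that nonempty sets contribute 1 when \<open>s = 0\<close>
  (whereas \<open>0 powr 0 = 0\<close> in HOL).
\<close>

definition diam_power :: "real \<Rightarrow> 'a::metric_space set \<Rightarrow> ennreal" where
  "diam_power s U =
     (if U = {} then 0 else if s = 0 then 1 else ennreal (diameter U powr s))"

text \<open>
  Boundedness is required explicitly because \<^const>\<open>diameter\<close> has no meaningful value on
  unbounded sets.
\<close>

definition delta_covers :: "real \<Rightarrow> 'a::metric_space set \<Rightarrow> (nat \<Rightarrow> 'a set) set" where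
  "delta_covers \<delta> S =
     {U. S \<subseteq> (\<Union>k. U k) \<and> (\<forall>k. bounded (U k) \<and> diameter (U k) \<le> \<delta>)}"

definition hausdorff_premeasure :: "real \<Rightarrow> real \<Rightarrow> 'a::metric_space set \<Rightarrow> ennreal" where
  "hausdorff_premeasure s \<delta> S = (INF U\<in>delta_covers \<delta> S. \<Sum>k. diam_power s (U k))"

definition hausdorff_measure :: "real \<Rightarrow> 'a::metric_space set \<Rightarrow> ennreal" where
  "hausdorff_measure s S = (SUP \<delta>\<in>{0<..}. hausdorff_premeasure s \<delta> S)"

definition hausdorff_dimension :: "'a::metric_space set \<Rightarrow> ennreal" where
  "hausdorff_dimension S = (INF s\<in>{s. 0 \<le> s \<and> hausdorff_measure s S = 0}. ennreal s)"

end

theory Submission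
  imports Defs
begin

text \<open>
  The discontinuity set contains a relatively open subset of the hyperplane of pairs \<open>(H, M)\<close> with
  \<open>trace M = 0\<close>. If \<open>det M = \<beta>\<^sup>2 > 0\<close>, then \<open>M\<close> is conjugate to \<open>\<beta>\<close> times a quarter turn and
  \<open>M\<^sup>2 = -\<beta>\<^sup>2\<close>. When \<open>H\<close> is strongly hyperbolic and \<open>M\<close> does not move its dominant direction close to
  its other eigendirection, both \<open>H\<close> and \<open>H M\<close> expand a common cone, so the lower spectral radius is
  at least \<open>\<beta>\<close>. Rotating by an angle slightly different from a quarter turn instead gives pairs
  \<open>(H, M')\<close> arbitrarily close to \<open>(H, M)\<close> for which a power \<open>Q\<close> of \<open>M'\<close> maps the dominant direction
  of \<open>H\<close> exactly onto the other one. Then \<open>H\<^sup>n Q H\<^sup>n\<close> has norm of order \<open>\<bar>det H\<bar>\<^sup>n\<close>, which bounds the lower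
  spectral radius by \<open>sqrt \<bar>det H\<bar> < \<beta>\<close>.
\<close>

section \<open>Submultiplicativity of the Frobenius norm and limits of roots\<close>

lemma norm_vector_matrix_mult_le:
  fixes x :: "real^'m" and B :: "real^'n^'m"
  shows "norm (x v* B) \<le> norm x * norm B"
proof -
  have "x v* B = (\<Sum>k\<in>UNIV. x $ k *\<^sub>R B $ k)"
    by (simp add: vec_eq_iff vector_matrix_mult_def mult.commute)
  also have "norm \<dots> \<le> (\<Sum>k\<in>UNIV. norm (x $ k *\<^sub>R B $ k))"
    by (rule norm_sum)
  also have "\<dots> = (\<Sum>k\<in>UNIV. \<bar>x $ k\<bar> * \<bar>norm (B $ k)\<bar>)"
    by simp
  also have "\<dots> \<le> L2_set (\<lambda>k. x $ k) UNIV * L2_set (\<lambda>k. norm (B $ k)) UNIV"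
    by (rule L2_set_mult_ineq)
  also have "\<dots> = norm x * norm B"
    by (simp add: norm_vec_def L2_set_def)
  finally show ?thesis .
qed

lemma norm_matrix_mult_le:
  fixes A :: "real^'m^'l" and B :: "real^'n^'m"
  shows "norm (A ** B) \<le> norm A * norm B"
proof -
  have "(A ** B) $ i = A $ i v* B" for i
    by (simp add: vec_eq_iff matrix_matrix_mult_def vector_matrix_mult_def mult.commute)
  then have "norm ((A ** B) $ i) \<le> norm (A $ i) * norm B" for i
    by (simp add: norm_vector_matrix_mult_le)
  then have "norm (A ** B) \<le> L2_set (\<lambda>i. norm (A $ i) * norm B) UNIV"
    unfolding norm_vec_def[of "A ** B"] by (intro L2_set_mono) auto
  also have "\<dots> = norm A * norm B"
    by (simp add: norm_vec_def[of A] L2_set_left_distrib)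
  finally show ?thesis .
qed

text \<open>Fekete's lemma in multiplicative form: the limit is the infimum of
  \<open>root n (a n)\<close> over positive \<open>n\<close>, which also yields the last clause.
  Arguing with roots instead of logarithms allows \<open>a n = 0\<close>.\<close>

lemma submultiplicative_root_limit:
  fixes a :: "nat \<Rightarrow> real"
  assumes nonneg: "\<And>n. 0 \<le> a n" and submult: "\<And>m n. a (m + n) \<le> a m * a n"
  obtains L where "0 \<le> L" "(\<lambda>n. root n (a n)) \<longlonglongrightarrow> L" "\<And>n. 0 < n \<Longrightarrow> L ^ n \<le> a n"
proof -
  define L where "L = (INF n\<in>{0<..}. root n (a n))"
  have bdd: "bdd_below ((\<lambda>n. root n (a n)) ` {0<..})"
    by (rule bdd_belowI[of _ 0]) (auto simp: nonneg)
  have le: "L \<le> root n (a n)" if "0 < n" for n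
    unfolding L_def using bdd that by (intro cINF_lower) auto
  have L0: "0 \<le> L"
    unfolding L_def by (rule cINF_greatest) (auto simp: nonneg)
  have pow: "L ^ n \<le> a n" if "0 < n" for n
    using power_mono[OF le[OF that] L0, of n] that nonneg by simp
  have upper: "eventually (\<lambda>n. root n (a n) < y) sequentially" if "L < y" for y
  proof -
    define c where "c = (L + y) / 2"
    have c: "L < c" "c < y" "0 < c"
      using that L0 by (auto simp: c_def)
    obtain k where k: "0 < k" "root k (a k) < c"
      using c(1) cINF_less_iff[OF _ bdd, of c] unfolding L_def by auto
    have ak: "a k \<le> c ^ k"
      using power_mono[of "root k (a k)" c k] k nonneg by simp
    \<comment> \<open>For \<open>n = q * k + r\<close> with \<open>r < k\<close>, the sum bounds the
      factor \<open>a r / c ^ r\<close> left by the remainder. The summand 1 makes \<open>M\<close>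
      positive, so that \<open>root n M\<close> tends to 1.\<close>
    define M where "M = 1 + (\<Sum>r<k. a r / c ^ r)"
    have M: "0 < M"
      unfolding M_def using nonneg c(3) by (intro add_pos_nonneg sum_nonneg) auto
    have bound: "a n \<le> c ^ n * M" for n
    proof -
      have step: "a (q * k + r) \<le> (c ^ k) ^ q * a r" for q r
      proof (induction q)
        case (Suc q)
        have "a (Suc q * k + r) \<le> a k * a (q * k + r)"
          using submult[of k "q * k + r"] by (simp add: add.assoc)
        also have "\<dots> \<le> c ^ k * ((c ^ k) ^ q * a r)"
          using Suc ak nonneg c(3) by (intro mult_mono) auto
        finally show ?case by (simp add: mult.assoc)
      qed simp
      have "a n \<le> (c ^ k) ^ (n div k) * a (n mod k)"
        using step[of "n div k" "n mod k"] by simp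
      also have "\<dots> = c ^ (k * (n div k) + n mod k) * (a (n mod k) / c ^ (n mod k))"
        using c(3) unfolding power_add power_mult by simp
      also have "\<dots> = c ^ n * (a (n mod k) / c ^ (n mod k))"
        by simp
      also have "a (n mod k) / c ^ (n mod k) \<le> (\<Sum>r<k. a r / c ^ r)"
        using k(1) nonneg c(3) by (intro member_le_sum) auto
      then have "c ^ n * (a (n mod k) / c ^ (n mod k)) \<le> c ^ n * M"
        unfolding M_def using c(3) by (intro mult_left_mono) auto
      finally show ?thesis .
    qed
    have "(\<lambda>n. c * root n M) \<longlonglongrightarrow> c * 1"
      by (intro tendsto_intros LIMSEQ_root_const M)
    then have "eventually (\<lambda>n. c * root n M < y) sequentially"
      using c(2) by (intro order_tendstoD(2)) auto
    then show ?thesis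
      using eventually_gt_at_top[of 0]
    proof eventually_elim
      case (elim n)
      have "root n (a n) \<le> root n (c ^ n * M)"
        using elim bound by simp
      also have "\<dots> = c * root n M"
        using elim c(3) by (simp add: real_root_mult real_root_power_cancel)
      finally show ?case using elim by simp
    qed
  qed
  have "(\<lambda>n. root n (a n)) \<longlonglongrightarrow> L"
  proof (rule order_tendstoI)
    fix y assume y: "y < L"
    show "eventually (\<lambda>n. y < root n (a n)) sequentially"
      using eventually_gt_at_top[of 0]
    proof eventually_elim
      case (elim n)
      then show ?case using le[of n] y by linarith
    qed
  qed (rule upper)
  with L0 show ?thesis using pow by (rule that)
qed

subsection \<open>Upper and lower bounds for the lower spectral radius\<close>

lemma word_product_append:
  "word_product A (u @ v) = word_product A v ** word_product A u"
  by (induction u) (auto simp: matrix_mul_assoc)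

lemma finite_index_words: "finite (index_words n)"
  unfolding index_words_def by (rule finite_subset[OF _ finite_lists_length_eq[of "{1,2}" n]]) auto

lemma replicate_in_index_words:
  assumes "i \<in> {1, 2}"
  shows "replicate n i \<in> index_words n"
  using assms by (auto simp: index_words_def)

lemma index_words_nonempty: "index_words n \<noteq> {}"
  using replicate_in_index_words[of 1 n] by auto

lemma index_words_append:
  "u \<in> index_words m \<Longrightarrow> v \<in> index_words n \<Longrightarrow> u @ v \<in> index_words (m + n)"
  by (auto simp: index_words_def)

text \<open>Concatenating minimising words makes the minimal norm \<open>a\<close>
  submultiplicative, so Fekete's lemma shows that the \<open>lim\<close> in the definition is a
  genuine limit, and moreover an infimum.\<close>

lemma lower_spectral_radius_limit:
  fixes A :: mat_pair
  defines "a \<equiv> (\<lambda>n. Min ((\<lambda>w. norm (word_product A w)) ` index_words n))"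
  shows "(\<lambda>n. root n (a n)) \<longlonglongrightarrow> lower_spectral_radius A"
    and "0 \<le> lower_spectral_radius A"
    and "0 < n \<Longrightarrow> lower_spectral_radius A ^ n \<le> a n"
proof -
  have a_in: "a n \<in> (\<lambda>w. norm (word_product A w)) ` index_words n" for n
    unfolding a_def using index_words_nonempty finite_index_words by (intro Min_in) auto
  have a_le: "a n \<le> norm (word_product A w)" if "w \<in> index_words n" for n w
    unfolding a_def using that finite_index_words by (intro Min_le) auto
  have nonneg: "0 \<le> a n" for n
    using a_in[of n] by auto
  have submult: "a (m + n) \<le> a m * a n" for m n
  proof -
    obtain u where u: "u \<in> index_words m" "a m = norm (word_product A u)"
      using a_in[of m] by auto
    obtain v where v: "v \<in> index_words n" "a n = norm (word_product A v)"
      using a_in[of n] by auto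
    have "a (m + n) \<le> norm (word_product A v ** word_product A u)"
      using a_le[OF index_words_append[OF u(1) v(1)]] by (simp add: word_product_append)
    also have "\<dots> \<le> a m * a n"
      using norm_matrix_mult_le u(2) v(2) by (metis mult.commute)
    finally show ?thesis .
  qed
  have "Min ((\<lambda>w. root n (norm (word_product A w))) ` index_words n) = root n (a n)" for n
  proof -
    \<comment> \<open>Monotonicity moves the root outside the minimum; \<open>root 0\<close> is
      constantly 0, hence the case distinction.\<close>
    have "mono (root n)"
      by (cases "n = 0") (auto simp: mono_def)
    then show ?thesis
      unfolding a_def using index_words_nonempty finite_index_words
      by (subst mono_Min_commute) (auto simp: image_image)
  qed
  then have def': "lower_spectral_radius A = lim (\<lambda>n. root n (a n))"
    by (simp add: lower_spectral_radius_def)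
  obtain L where L: "0 \<le> L" "(\<lambda>n. root n (a n)) \<longlonglongrightarrow> L" "\<And>n. 0 < n \<Longrightarrow> L ^ n \<le> a n"
    using submultiplicative_root_limit[of a] nonneg submult by metis
  have "lower_spectral_radius A = L"
    using L(2) def' by (simp add: limI)
  with L show "(\<lambda>n. root n (a n)) \<longlonglongrightarrow> lower_spectral_radius A"
    "0 \<le> lower_spectral_radius A" "0 < n \<Longrightarrow> lower_spectral_radius A ^ n \<le> a n"
    by auto
qed

text \<open>The limit is an infimum, so any single nonempty word yields an upper bound.\<close>

lemma lower_spectral_radius_power_le:
  assumes "w \<in> index_words n" "0 < n"
  shows "lower_spectral_radius A ^ n \<le> norm (word_product A w)"
  using lower_spectral_radius_limit(3)[OF assms(2), of A] assms(1) finite_index_words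
  by (meson Min_le finite_imageI image_eqI order_trans)

text \<open>The uniform constant \<open>c\<close> is lost in the limit, since
  \<open>root n c\<close> tends to 1.\<close>

lemma le_lower_spectral_radius:
  assumes c: "0 < c" and b: "0 \<le> b"
    and bound: "\<And>w. set w \<subseteq> {1, 2} \<Longrightarrow> c * b ^ length w \<le> norm (word_product A w)"
  shows "b \<le> lower_spectral_radius A"
proof (rule LIMSEQ_le[OF _ lower_spectral_radius_limit(1)])
  have "(\<lambda>n. root n c * b) \<longlonglongrightarrow> 1 * b"
    by (intro tendsto_intros LIMSEQ_root_const c)
  then show "(\<lambda>n. root n c * b) \<longlonglongrightarrow> b" by simp
  have "root n c * b \<le> root n (Min ((\<lambda>w. norm (word_product A w)) ` index_words n))"
    if n: "1 \<le> n" for n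
  proof -
    have "c * b ^ n \<le> Min ((\<lambda>w. norm (word_product A w)) ` index_words n)"
      using index_words_nonempty finite_index_words
      by (intro Min.boundedI) (auto simp: index_words_def bound)
    then have "root n (c * b ^ n) \<le> root n (Min ((\<lambda>w. norm (word_product A w)) ` index_words n))"
      using n by simp
    then show ?thesis
      using n b by (simp add: real_root_mult real_root_power_cancel)
  qed
  then show "\<exists>N. \<forall>n\<ge>N. root n c * b \<le> root n (Min ((\<lambda>w. norm (word_product A w)) ` index_words n))"
    by blast
qed

subsection \<open>Hausdorff dimension and linear images\<close>

text \<open>The Lipschitz images of the sets of a cover of \<open>S\<close> cover \<open>T\<close>,
  which has positive Lebesgue measure. Enclosing each image in a cube keeps the cover sums for
  \<open>s < DIM('b)\<close> away from 0.\<close>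

lemma hausdorff_dimension_ge_DIM:
  fixes f :: "'a::real_normed_vector \<Rightarrow> 'b::euclidean_space"
  assumes f: "bounded_linear f" and T: "open T" "T \<noteq> {}" "T \<subseteq> f ` S"
  shows "ennreal (real DIM('b)) \<le> hausdorff_dimension S"
proof -
  obtain L where L: "0 < L" "\<And>x. norm (f x) \<le> norm x * L"
    using bounded_linear.pos_bounded[OF f] by auto
  have lip: "norm (f x - f y) \<le> L * dist x y" for x y
    using L(2)[of "x - y"] bounded_linear.linear[OF f]
    by (simp add: linear_diff dist_norm mult.commute)
  have T_pos: "0 < emeasure lborel T"
  proof -
    have "emeasure lborel T \<noteq> 0"
      using T open_not_negligible[OF T(1,2)]
      by (simp add: negligible_iff_null_sets null_sets_def emeasure_completion[symmetric])
    then show ?thesis by (simp add: zero_less_iff_neq_zero)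
  qed
  have "real DIM('b) \<le> s" if s: "0 \<le> s" "hausdorff_measure s S = 0" for s
  proof (rule ccontr)
    assume "\<not> real DIM('b) \<le> s"
    then have less: "s < real DIM('b)" by simp
    define C where "C = ennreal ((2 * L) ^ DIM('b))"
    have C: "0 < C" "C < top"
      using L(1) by (auto simp: C_def)
    \<comment> \<open>The scale 1 suffices: for \<open>d \<le> 1\<close> and
      \<open>s < DIM('b)\<close> the volume order \<open>d ^ DIM('b)\<close> is at most
      \<open>d powr s\<close>, and the premeasure at one scale is a lower bound for the
      measure.\<close>
    have key: "emeasure lborel T / C \<le> (\<Sum>k. diam_power s (U k))"
      if U: "U \<in> delta_covers 1 S" for U
    proof -
      have cover: "S \<subseteq> (\<Union>k. U k)" and bd: "\<And>k. bounded (U k)"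
        and diam: "\<And>k. diameter (U k) \<le> 1"
        using U by (auto simp: delta_covers_def)
      have "\<exists>B\<in>sets lborel. f ` U k \<subseteq> B \<and> emeasure lborel B \<le> C * diam_power s (U k)" for k
      proof (cases "U k = {}")
        case True
        then show ?thesis by (intro bexI[of _ "{}"]) auto
      next
        case False
        then obtain x where x: "x \<in> U k" by auto
        define d where "d = diameter (U k)"
        have d: "0 \<le> d" "d \<le> 1"
          using diam by (auto simp: d_def diameter_ge_0 bd)
        \<comment> \<open>A measurable replacement for the image of \<open>U k\<close>: a cube of
          half side \<open>L * d\<close> about \<open>f x\<close>.\<close>
        define B where "B = cbox (f x - (L * d) *\<^sub>R One) (f x + (L * d) *\<^sub>R One)"
        have "f ` U k \<subseteq> B"
        proof clarify
          fix y assume y: "y \<in> U k"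
          have "norm (f y - f x) \<le> L * d"
            using lip[of y x] diameter_bounded_bound[OF bd y x] L(1)
            by (smt (verit) d_def mult_left_mono)
          then have "\<bar>(f y - f x) \<bullet> b\<bar> \<le> L * d" if "b \<in> Basis" for b
            using Basis_le_norm[OF that, of "f y - f x"] by linarith
          then have "\<bar>f y \<bullet> b - f x \<bullet> b\<bar> \<le> L * d" if "b \<in> Basis" for b
            using that by (simp add: inner_diff_left)
          then show "f y \<in> B"
            by (auto simp: B_def mem_box inner_diff_left inner_add_left abs_le_iff
                algebra_simps)
        qed
        moreover have "emeasure lborel B = ennreal ((2 * L * d) ^ DIM('b))"
          using L(1) d
          by (simp add: B_def emeasure_lborel_cbox_eq inner_diff_left inner_add_left algebra_simps)
        \<comment> \<open>The case \<open>s = 0\<close> is separate because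
          \<open>diam_power\<close> is then 1 even for sets of diameter 0.\<close>
        moreover have "ennreal ((2 * L * d) ^ DIM('b)) \<le> C * diam_power s (U k)"
        proof (cases "s = 0")
          case True
          have "(2 * L * d) ^ DIM('b) \<le> (2 * L) ^ DIM('b)"
            using L(1) d by (intro power_mono) (auto simp: mult_left_le)
          then show ?thesis
            using True False by (simp add: C_def diam_power_def ennreal_leI)
        next
          case s0: False
          have "d ^ DIM('b) \<le> d powr s"
          proof (cases "d = 0")
            case False
            then have "d ^ DIM('b) = d powr real DIM('b)"
              using d by (simp add: powr_realpow)
            also have "\<dots> \<le> d powr s"
              using less d by (intro powr_mono') auto
            finally show ?thesis .
          qed (simp add: zero_power)
          then have "(2 * L * d) ^ DIM('b) \<le> (2 * L) ^ DIM('b) * d powr s"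
            using L(1) by (simp add: power_mult_distrib)
          then show ?thesis
            using s0 False L(1)
            by (simp add: C_def diam_power_def d_def ennreal_mult[symmetric] ennreal_leI)
        qed
        ultimately show ?thesis
          by (intro bexI[of _ B]) (auto simp: B_def)
      qed
      then obtain B where B: "\<And>k. B k \<in> sets lborel" "\<And>k. f ` U k \<subseteq> B k"
        "\<And>k. emeasure lborel (B k) \<le> C * diam_power s (U k)"
        by metis
      have "T \<subseteq> (\<Union>k. B k)"
      proof -
        have "f ` S \<subseteq> (\<Union>k. f ` U k)"
          using image_mono[OF cover, of f] by (simp add: image_UN)
        also have "\<dots> \<subseteq> (\<Union>k. B k)"
          by (intro UN_mono order_refl B(2))
        finally show ?thesis using T(3) by simp
      qed
      then have "emeasure lborel T \<le> emeasure lborel (\<Union>k. B k)"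
        using B(1) by (intro emeasure_mono) auto
      also have "\<dots> \<le> (\<Sum>k. emeasure lborel (B k))"
        using B(1) by (intro emeasure_subadditive_countably) auto
      also have "\<dots> \<le> (\<Sum>k. C * diam_power s (U k))"
        using B(3) by (intro suminf_le) auto
      also have "\<dots> = C * (\<Sum>k. diam_power s (U k))"
        by simp
      finally show ?thesis
        using C(1) by (intro divide_le_posI_ennreal)
    qed
    have "0 < emeasure lborel T / C"
      using T_pos C by (simp add: ennreal_zero_less_divide)
    also have "\<dots> \<le> hausdorff_premeasure s 1 S"
      unfolding hausdorff_premeasure_def by (rule INF_greatest) (rule key)
    also have "\<dots> \<le> hausdorff_measure s S"
      unfolding hausdorff_measure_def by (rule SUP_upper) simp
    finally show False using s(2) by simp
  qed
  then show ?thesis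
    unfolding hausdorff_dimension_def by (intro INF_greatest) (auto intro: ennreal_leI)
qed


subsection \<open>Perturbations with small lower spectral radius\<close>

lemma scaleR_matrix_mult_left:
  fixes A :: "real^'m^'l" and B :: "real^'n^'m"
  shows "(c *\<^sub>R A) ** B = c *\<^sub>R (A ** B)"
  by (simp add: vec_eq_iff matrix_matrix_mult_def sum_distrib_left mult.assoc)

lemma scaleR_matrix_mult_right:
  fixes A :: "real^'m^'l" and B :: "real^'n^'m"
  shows "A ** (c *\<^sub>R B) = c *\<^sub>R (A ** B)"
  by (simp add: vec_eq_iff matrix_matrix_mult_def sum_distrib_left mult_ac)

lemma matrix_mult_add_left:
  fixes A :: "real^'m^'l" and B :: "real^'n^'m"
  shows "(A + C) ** B = A ** B + C ** B"
  by (simp add: vec_eq_iff matrix_matrix_mult_def sum.distrib distrib_right)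

lemma matrix_mult_diff_left:
  fixes A :: "real^'m^'l" and B :: "real^'n^'m"
  shows "(A - C) ** B = A ** B - C ** B"
  by (simp add: vec_eq_iff matrix_matrix_mult_def sum_subtractf left_diff_distrib)

lemma matrix_mult_diff_right:
  fixes A :: "real^'m^'l" and B :: "real^'n^'m"
  shows "A ** (B - C) = A ** B - A ** C"
  by (simp add: vec_eq_iff matrix_matrix_mult_def sum_subtractf right_diff_distrib)

text \<open>Otherwise division by \<open>r ^ (2 * n)\<close> bounds the positive number
  \<open>r ^ k\<close> by a null sequence.\<close>

lemma le_if_power_le:
  fixes r s C :: real
  assumes s: "0 \<le> s" and bound: "\<And>n. r ^ (2 * n + k) \<le> C * s ^ (2 * n)"
  shows "r \<le> s"
proof (rule ccontr)
  assume "\<not> r \<le> s"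
  then have r: "s < r" "0 < r" using s by auto
  define q where "q = (s / r)\<^sup>2"
  have q: "0 \<le> q" "q < 1"
    using r s by (auto simp: q_def power_less_one_iff abs_square_less_1)
  have "r ^ k \<le> C * q ^ n" for n
    using bound[of n] r(2)
    by (simp add: q_def power_add power_mult[symmetric] power_divide field_simps)
  moreover have "(\<lambda>n. C * q ^ n) \<longlonglongrightarrow> C * 0"
    using q by (intro tendsto_intros LIMSEQ_power_zero) auto
  ultimately have "r ^ k \<le> C * 0"
    by (intro LIMSEQ_le_const) auto
  then show False
    using zero_less_power[OF r(2), of k] by simp
qed

text \<open>\<open>E\<close> and \<open>mat 1 - E\<close> are complementary projections whose mixed
  products vanish, so each eigenvalue is raised to the power separately.\<close>

lemma word_product_replicate_idempotent:
  assumes E: "E ** E = E" and H: "H = \<nu> *\<^sub>R E + \<mu> *\<^sub>R (mat 1 - E)"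
  shows "word_product (H, M) (replicate n 1) = \<nu> ^ n *\<^sub>R E + \<mu> ^ n *\<^sub>R (mat 1 - E)"
proof (induction n)
  case (Suc n)
  then show ?case
    by (simp add: pair_nth_def H matrix_add_ldistrib matrix_mult_add_left matrix_mult_diff_left
        matrix_mult_diff_right scaleR_matrix_mult_left scaleR_matrix_mult_right E mult.commute)
qed simp

text \<open>
  The hypothesis on \<open>Q\<close> says that it maps the dominant eigendirection of \<open>H\<close> into the other one,
  so that in \<open>H\<^sup>n Q H\<^sup>n\<close> the term of order \<open>\<nu>\<^sup>2\<^sup>n\<close> vanishes.
\<close>

lemma lower_spectral_radius_le_if_heteroclinic:
  fixes H M :: "real^2^2"
  defines "Q \<equiv> \<lambda>k. word_product (H, M) (replicate k 2)"
  assumes E: "E ** E = E" and H: "H = \<nu> *\<^sub>R E + \<mu> *\<^sub>R (mat 1 - E)"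
    and le: "\<bar>\<mu>\<bar> \<le> \<bar>\<nu>\<bar>" and k: "0 < k" and EQE: "E ** Q k ** E = 0"
  shows "lower_spectral_radius (H, M) \<le> sqrt \<bar>\<nu> * \<mu>\<bar>"
proof -
  define F where "F = mat 1 - E"
  define C where "C = norm (E ** Q k ** F) + norm (F ** Q k ** E) + norm (F ** Q k ** F)"
  have "lower_spectral_radius (H, M) ^ (2 * n + k) \<le> C * sqrt \<bar>\<nu> * \<mu>\<bar> ^ (2 * n)" for n
  proof -
    define w :: "nat list" where "w = (replicate n 1 @ replicate k 2) @ replicate n 1"
    have "w \<in> index_words ((n + k) + n)"
      unfolding w_def by (intro index_words_append replicate_in_index_words) auto
    then have "lower_spectral_radius (H, M) ^ (2 * n + k) \<le> norm (word_product (H, M) w)"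
      using lower_spectral_radius_power_le[of w "n + k + n" "(H, M)"] k
      by (simp add: mult_2 add_ac)
    also have "word_product (H, M) w
        = (\<nu> ^ n *\<^sub>R E + \<mu> ^ n *\<^sub>R F) ** Q k ** (\<nu> ^ n *\<^sub>R E + \<mu> ^ n *\<^sub>R F)"
      unfolding w_def word_product_append word_product_replicate_idempotent[OF E H] F_def Q_def
      by (simp add: matrix_mul_assoc)
    also have "\<dots> = (\<nu> * \<mu>) ^ n *\<^sub>R (E ** Q k ** F) + (\<nu> * \<mu>) ^ n *\<^sub>R (F ** Q k ** E)
        + (\<mu> * \<mu>) ^ n *\<^sub>R (F ** Q k ** F)"
      using EQE
      by (simp add: matrix_add_ldistrib matrix_mult_add_left scaleR_matrix_mult_left
          scaleR_matrix_mult_right power_mult_distrib mult.commute scaleR_add_right)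
    also have "norm \<dots> \<le> norm ((\<nu> * \<mu>) ^ n *\<^sub>R (E ** Q k ** F))
        + norm ((\<nu> * \<mu>) ^ n *\<^sub>R (F ** Q k ** E)) + norm ((\<mu> * \<mu>) ^ n *\<^sub>R (F ** Q k ** F))"
      by (intro order_trans[OF norm_triangle_ineq] add_mono norm_triangle_ineq order_refl)
    \<comment> \<open>Since \<open>\<bar>\<mu>\<bar> \<le> \<bar>\<nu>\<bar>\<close>, the term with
      \<open>\<mu> * \<mu>\<close> is also of order at most
      \<open>\<bar>\<nu> * \<mu>\<bar> ^ n\<close>.\<close>
    also have "\<dots> \<le> \<bar>\<nu> * \<mu>\<bar> ^ n * norm (E ** Q k ** F) + \<bar>\<nu> * \<mu>\<bar> ^ n * norm (F ** Q k ** E)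
        + \<bar>\<nu> * \<mu>\<bar> ^ n * norm (F ** Q k ** F)"
      unfolding norm_scaleR power_abs
      by (intro add_mono mult_right_mono order_refl power_mono)
        (use mult_right_mono[OF le, of "\<bar>\<mu>\<bar>"] in \<open>auto simp: abs_mult\<close>)
    also have "\<dots> = C * sqrt \<bar>\<nu> * \<mu>\<bar> ^ (2 * n)"
    proof -
      have "sqrt \<bar>\<nu> * \<mu>\<bar> ^ (2 * n) = \<bar>\<nu> * \<mu>\<bar> ^ n"
        by (simp add: power_mult)
      then show ?thesis by (simp add: C_def algebra_simps)
    qed
    finally show ?thesis .
  qed
  then show ?thesis
    by (rule le_if_power_le[rotated]) simp
qed

text \<open>De Moivre's formula with \<open>J\<close> in the role of the imaginary unit.\<close>

lemma word_product_replicate_rotation: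
  assumes J: "J ** J = - mat 1" and M: "M = \<beta> *\<^sub>R (cos \<phi> *\<^sub>R mat 1 + sin \<phi> *\<^sub>R J)"
  shows "word_product (H, M) (replicate k 2)
    = \<beta> ^ k *\<^sub>R (cos (k * \<phi>) *\<^sub>R mat 1 + sin (k * \<phi>) *\<^sub>R J)"
proof (induction k)
  case (Suc k)
  have mult: "(x *\<^sub>R (a *\<^sub>R mat 1 + b *\<^sub>R J)) ** (\<beta> *\<^sub>R (c *\<^sub>R mat 1 + d *\<^sub>R J))
    = (\<beta> * x) *\<^sub>R ((a * c - b * d) *\<^sub>R mat 1 + (b * c + a * d) *\<^sub>R J)" for x a b c d
    by (simp add: matrix_add_ldistrib matrix_mult_add_left J
        scaleR_matrix_mult_left scaleR_matrix_mult_right algebra_simps)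
  have "cos (Suc k * \<phi>) = cos (k * \<phi>) * cos \<phi> - sin (k * \<phi>) * sin \<phi>"
    "sin (Suc k * \<phi>) = sin (k * \<phi>) * cos \<phi> + cos (k * \<phi>) * sin \<phi>"
    by (simp_all add: distrib_right cos_add sin_add add.commute)
  with Suc show ?case
    by (simp add: pair_nth_def M mult)
qed simp

text \<open>A singular \<open>E\<close> is an outer product of vectors u and v, so Q enters only
  through the scalar v Q u, the trace of \<open>Q ** E\<close>. The heteroclinic condition
  \<open>E ** Q ** E = 0\<close> thus follows from one scalar equation.\<close>

lemma singular_sandwich_2:
  fixes E Q :: "real^2^2"
  assumes "det E = 0"
  shows "E ** Q ** E = trace (Q ** E) *\<^sub>R E"
proof -
  have d: "E $ 1 $ 1 * E $ 2 $ 2 = E $ 1 $ 2 * E $ 2 $ 1"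
    using assms by (simp add: det_2)
  show ?thesis
    unfolding vec_eq_iff forall_2 matrix_matrix_mult_def trace_def
    using d by (simp add: sum_2) algebra
qed

text \<open>The discriminant condition gives distinct real eigenvalues, and the sign of the trace
  makes \<open>\<nu>\<close> the dominant one. \<open>E\<close> is the projection onto the eigenline
  of \<open>\<nu>\<close> along that of \<open>\<mu>\<close>.\<close>

lemma spectral_projection_2:
  fixes H :: "real^2^2"
  assumes tr: "0 \<le> trace H" and D: "4 * det H < (trace H)\<^sup>2"
  obtains E \<nu> \<mu> where "E ** E = E" "H = \<nu> *\<^sub>R E + \<mu> *\<^sub>R (mat 1 - E)" "\<bar>\<mu>\<bar> \<le> \<bar>\<nu>\<bar>"
    "\<nu> * \<mu> = det H" "det E = 0" "trace E = 1"
proof -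
  define r where "r = sqrt ((trace H)\<^sup>2 - 4 * det H)"
  have r: "0 < r" "r\<^sup>2 = (trace H)\<^sup>2 - 4 * det H"
    using D by (auto simp: r_def)
  define \<nu> where "\<nu> = (trace H + r) / 2"
  define \<mu> where "\<mu> = (trace H - r) / 2"
  have sum: "\<nu> + \<mu> = H $ 1 $ 1 + H $ 2 $ 2"
    by (simp add: \<nu>_def \<mu>_def field_simps trace_def sum_2)
  have prod: "\<nu> * \<mu> = det H"
    using r(2) by (simp add: \<nu>_def \<mu>_def field_simps power2_eq_square)
  have prod': "\<nu> * \<mu> = H $ 1 $ 1 * H $ 2 $ 2 - H $ 1 $ 2 * H $ 2 $ 1"
    using prod by (simp add: det_2)
  have ne: "\<nu> - \<mu> \<noteq> 0"
    using r(1) by (simp add: \<nu>_def \<mu>_def field_simps)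
  define G where "G = H - \<mu> *\<^sub>R mat 1"
  define E where "E = (1 / (\<nu> - \<mu>)) *\<^sub>R G"
  \<comment> \<open>Cayley-Hamilton: \<open>H - \<mu>\<close> annihilates \<open>H - \<nu>\<close>,
    and \<open>G\<close> differs from the latter by the scalar \<open>\<nu> - \<mu>\<close>.\<close>
  have GG: "G ** G = (\<nu> - \<mu>) *\<^sub>R G"
    unfolding G_def vec_eq_iff forall_2 matrix_matrix_mult_def
    using sum prod' by (simp add: sum_2 mat_def) algebra
  show ?thesis
  proof
    show "E ** E = E"
      using ne by (simp add: E_def scaleR_matrix_mult_left scaleR_matrix_mult_right GG)
    have "\<nu> *\<^sub>R E + \<mu> *\<^sub>R (mat 1 - E) = (\<nu> - \<mu>) *\<^sub>R E + \<mu> *\<^sub>R mat 1"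
      by (simp add: algebra_simps)
    then show "H = \<nu> *\<^sub>R E + \<mu> *\<^sub>R (mat 1 - E)"
      using ne by (simp add: E_def G_def)
    show "\<bar>\<mu>\<bar> \<le> \<bar>\<nu>\<bar>"
      using tr r(1) by (simp add: \<nu>_def \<mu>_def)
    have "G $ 1 $ 1 * G $ 2 $ 2 - G $ 1 $ 2 * G $ 2 $ 1 = 0"
      unfolding G_def using sum prod' by (simp add: mat_def) algebra
    then show "det E = 0"
      by (simp add: E_def det_2 algebra_simps)
    have "G $ 1 $ 1 + G $ 2 $ 2 = \<nu> - \<mu>"
      using sum by (simp add: G_def mat_def)
    then show "trace E = 1"
      using ne by (simp add: E_def trace_def sum_2 add_divide_distrib[symmetric])
  qed (rule prod)
qed

text \<open>Some rotation angle \<open>\<psi>\<close> turns the dominant eigenline of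
  \<open>H\<close> onto the other one. It is reached, up to full turns, as a multiple of angles
  arbitrarily close to a quarter turn.\<close>

lemma quarter_turn_perturbation:
  fixes H J :: "real^2^2"
  assumes J: "J ** J = - mat 1" and tr: "0 \<le> trace H" and D: "4 * det H < (trace H)\<^sup>2"
  obtains X where "X \<longlonglongrightarrow> \<beta> *\<^sub>R J" "\<And>m. lower_spectral_radius (H, X m) \<le> sqrt \<bar>det H\<bar>"
proof -
  obtain E \<nu> \<mu> where E: "E ** E = E" "H = \<nu> *\<^sub>R E + \<mu> *\<^sub>R (mat 1 - E)" "\<bar>\<mu>\<bar> \<le> \<bar>\<nu>\<bar>"
    "\<nu> * \<mu> = det H" "det E = 0" "trace E = 1"
    using spectral_projection_2[OF tr D] by blast
  \<comment> \<open>Solves \<open>cos \<psi> + sin \<psi> * t = 0\<close> for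
    \<open>t = trace (J ** E)\<close>. As \<open>trace E = 1\<close>, this is the vanishing of the
    trace of the rotation by \<open>\<psi>\<close> times \<open>E\<close>.\<close>
  define \<psi> where "\<psi> = pi / 2 + arctan (trace (J ** E))"
  have \<psi>: "cos \<psi> + sin \<psi> * trace (J ** E) = 0"
  proof -
    have "trace (J ** E) = sin (arctan (trace (J ** E))) / cos (arctan (trace (J ** E)))"
      using tan_arctan[of "trace (J ** E)"] by (simp add: tan_def)
    then have "trace (J ** E) * cos (arctan (trace (J ** E))) = sin (arctan (trace (J ** E)))"
      by (simp add: field_simps)
    then show ?thesis
      by (simp add: \<psi>_def cos_add sin_add mult.commute)
  qed
  \<comment> \<open>After \<open>4 * Suc m\<close> rotations the quarter turns add up to
    \<open>Suc m\<close> full turns and the corrections to exactly \<open>\<psi>\<close>.\<close>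
  define \<phi> where "\<phi> = (\<lambda>m. pi / 2 + \<psi> / (4 * real (Suc m)))"
  define X where "X = (\<lambda>m. \<beta> *\<^sub>R (cos (\<phi> m) *\<^sub>R mat 1 + sin (\<phi> m) *\<^sub>R J))"
  have "(\<lambda>m. pi / 2 + \<psi> / 4 * inverse (real (Suc m))) \<longlonglongrightarrow> pi / 2 + \<psi> / 4 * 0"
    by (rule tendsto_add[OF tendsto_const tendsto_mult[OF tendsto_const LIMSEQ_inverse_real_of_nat]])
  moreover have "\<phi> = (\<lambda>m. pi / 2 + \<psi> / 4 * inverse (real (Suc m)))"
    by (rule ext) (simp add: \<phi>_def inverse_eq_divide)
  ultimately have "\<phi> \<longlonglongrightarrow> pi / 2" by simp
  then have "X \<longlonglongrightarrow> \<beta> *\<^sub>R (cos (pi / 2) *\<^sub>R mat 1 + sin (pi / 2) *\<^sub>R J)"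
    unfolding X_def by (intro tendsto_intros)
  then have lim: "X \<longlonglongrightarrow> \<beta> *\<^sub>R J" by simp
  have "lower_spectral_radius (H, X m) \<le> sqrt \<bar>\<nu> * \<mu>\<bar>" for m
  proof (rule lower_spectral_radius_le_if_heteroclinic[OF E(1-3)])
    define k where "k = 4 * Suc m"
    have "real k * \<phi> m = \<psi> + 2 * real (Suc m) * pi"
      by (simp add: k_def \<phi>_def field_simps)
    then have angle: "cos (k * \<phi> m) = cos \<psi>" "sin (k * \<phi> m) = sin \<psi>"
      by (simp_all only: cos_add sin_add cos_2npi sin_2npi)
    have "word_product (H, X m) (replicate k 2) = \<beta> ^ k *\<^sub>R (cos \<psi> *\<^sub>R mat 1 + sin \<psi> *\<^sub>R J)"
      using word_product_replicate_rotation[OF J, of "X m" \<beta> "\<phi> m" H k]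
      unfolding angle by (simp only: X_def)
    moreover have "trace ((cos \<psi> *\<^sub>R mat 1 + sin \<psi> *\<^sub>R J) ** E)
        = cos \<psi> * trace E + sin \<psi> * trace (J ** E)"
      by (simp add: matrix_mult_add_left scaleR_matrix_mult_left trace_def sum_2 distrib_left)
    then have "trace ((cos \<psi> *\<^sub>R mat 1 + sin \<psi> *\<^sub>R J) ** E) = 0"
      using \<psi> E(6) by simp
    ultimately show "E ** word_product (H, X m) (replicate k 2) ** E = 0"
      using singular_sandwich_2[OF E(5)]
      by (simp add: scaleR_matrix_mult_left scaleR_matrix_mult_right)
    show "0 < k" by (simp add: k_def)
  qed
  with lim that show ?thesis using E(4) by metis
qed

subsection \<open>Discontinuity at pairs with an invariant cone\<close>

text \<open>A double cone, hence invariant under negative scalars such as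
  \<open>M\<^sup>2 = -\<beta>\<^sup>2\<close>. The slope 1/8 is small enough that \<open>M\<close>
  near the model keeps the cone away from the vertical axis, the kernel of the model of
  \<open>H\<close>.\<close>

definition horizontal_cone :: "(real^2) set" where
  "horizontal_cone = {v. \<bar>v $ 2\<bar> \<le> \<bar>v $ 1\<bar> / 8}"

text \<open>Each letter is credited with a factor \<open>\<beta>\<close>. A single \<open>M\<close>
  receives its credit before it is earned: a following \<open>H\<close> gives a factor of at least
  \<open>2 \<ge> \<beta>\<^sup>2\<close> for the two letters, a following \<open>M\<close> gives
  exactly \<open>\<beta>\<^sup>2\<close>, and a final unpaired \<open>M\<close> costs only a
  constant.\<close>

lemma lower_spectral_radius_ge_if_cone:
  fixes H M :: "real^2^2"
  assumes H: "\<And>v. v \<in> horizontal_cone \<Longrightarrow> H *v v \<in> horizontal_cone \<and> 2 * \<bar>v $ 1\<bar> \<le> \<bar>(H *v v) $ 1\<bar>"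
    and HM: "\<And>v. v \<in> horizontal_cone \<Longrightarrow>
      H *v (M *v v) \<in> horizontal_cone \<and> 2 * \<bar>v $ 1\<bar> \<le> \<bar>(H *v (M *v v)) $ 1\<bar>"
    and M: "\<And>v. v \<in> horizontal_cone \<Longrightarrow> \<bar>v $ 1\<bar> / 2 \<le> \<bar>(M *v v) $ 1\<bar>"
    and MM: "M ** M = - (\<beta>\<^sup>2 *\<^sub>R mat 1)" and \<beta>: "0 < \<beta>" "\<beta>\<^sup>2 \<le> 2"
  shows "\<beta> \<le> lower_spectral_radius (H, M)"
proof -
  have \<beta>2: "\<beta> \<le> 2"
    by (rule power2_le_imp_le) (use \<beta>(2) in auto)
  \<comment> \<open>\<open>M\<close> need not preserve the cone, but \<open>M\<^sup>2\<close> is scalar, so the orbit alternates between the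
    cone and its image under \<open>M\<close>.\<close>
  define good where "good r v \<longleftrightarrow> (v \<in> horizontal_cone \<and> r \<le> \<bar>v $ 1\<bar>) \<or>
    (\<exists>u\<in>horizontal_cone. v = M *v u \<and> r \<le> \<beta> * \<bar>u $ 1\<bar>)" for r and v :: "real^2"
  have MMv: "M *v (M *v u) = - (\<beta>\<^sup>2 *\<^sub>R u)" for u
  proof -
    have "M *v (M *v u) = (- (\<beta>\<^sup>2 *\<^sub>R mat 1)) *v u"
      by (simp add: matrix_vector_mul_assoc MM)
    also have "\<dots> = - (\<beta>\<^sup>2 *\<^sub>R u)"
      by (simp add: vec_eq_iff matrix_vector_mult_def sum_2 forall_2 mat_def)
    finally show ?thesis .
  qed
  have step_H: "good (\<beta> * r) (H *v v)" if "good r v" for r v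
    using that unfolding good_def[of r]
  proof (elim disjE conjE bexE)
    assume v: "v \<in> horizontal_cone" "r \<le> \<bar>v $ 1\<bar>"
    have "\<beta> * r \<le> \<beta> * \<bar>v $ 1\<bar>"
      using v(2) \<beta>(1) by simp
    also have "\<dots> \<le> 2 * \<bar>v $ 1\<bar>"
      using \<beta>2 by (intro mult_right_mono) auto
    finally show ?thesis
      using H[OF v(1)] by (auto simp: good_def)
  next
    fix u assume u: "u \<in> horizontal_cone" "v = M *v u" "r \<le> \<beta> * \<bar>u $ 1\<bar>"
    have "\<beta> * r \<le> \<beta>\<^sup>2 * \<bar>u $ 1\<bar>"
      using u(3) \<beta>(1) by (simp add: power2_eq_square mult.assoc)
    also have "\<dots> \<le> 2 * \<bar>u $ 1\<bar>"
      using \<beta>(2) by (intro mult_right_mono) auto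
    finally show ?thesis
      using HM[OF u(1)] u(2) by (auto simp: good_def)
  qed
  have step_M: "good (\<beta> * r) (M *v v)" if "good r v" for r v
    using that unfolding good_def[of r]
  proof (elim disjE conjE bexE)
    assume "v \<in> horizontal_cone" "r \<le> \<bar>v $ 1\<bar>"
    then show ?thesis
      using \<beta>(1) by (auto simp: good_def)
  next
    fix u assume u: "u \<in> horizontal_cone" "v = M *v u" "r \<le> \<beta> * \<bar>u $ 1\<bar>"
    have "\<beta> * r \<le> \<beta>\<^sup>2 * \<bar>u $ 1\<bar>"
      using u(3) \<beta>(1) by (simp add: power2_eq_square mult.assoc)
    moreover have "- (\<beta>\<^sup>2 *\<^sub>R u) \<in> horizontal_cone"
      using u(1) mult_left_mono[of "\<bar>u $ 2\<bar>" "\<bar>u $ 1\<bar> / 8" "\<beta>\<^sup>2"]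
      by (simp add: horizontal_cone_def abs_mult)
    ultimately show ?thesis
      by (simp add: good_def u(2) MMv abs_mult)
  qed
  have good_word: "good (\<beta> ^ length w * r) (word_product (H, M) w *v v)"
    if "good r v" for w r v
    using that
  proof (induction w arbitrary: r v)
    case (Cons i w)
    have "good (\<beta> * r) (pair_nth (H, M) i *v v)"
      using step_H step_M Cons.prems by (simp add: pair_nth_def)
    from Cons.IH[OF this] show ?case
      by (simp add: matrix_vector_mul_assoc mult_ac)
  qed simp
  \<comment> \<open>In the second case of \<open>good\<close>, the first coordinate is at least
    \<open>\<bar>u $ 1\<bar> / 2\<close>, while \<open>r \<le> \<beta> * \<bar>u $ 1\<bar> \<le> 2 *
    \<bar>u $ 1\<bar>\<close>; this gives the 1/4.\<close>
  have good_le: "1 / 4 * r \<le> \<bar>v $ 1\<bar>" if "good r v" for r v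
    using that unfolding good_def
  proof (elim disjE conjE bexE)
    fix u assume u: "u \<in> horizontal_cone" "v = M *v u" "r \<le> \<beta> * \<bar>u $ 1\<bar>"
    have "r \<le> 2 * \<bar>u $ 1\<bar>"
      using u(3) \<beta>2 mult_right_mono[of \<beta> 2 "\<bar>u $ 1\<bar>"] by simp
    then show ?thesis
      using M[OF u(1)] u(2) by simp
  qed auto
  have "1 / 4 * \<beta> ^ length w \<le> norm (word_product (H, M) w)" for w
  proof -
    have "good 1 (axis 1 1)"
      by (simp add: good_def horizontal_cone_def axis_def)
    then have "1 / 4 * \<beta> ^ length w \<le> \<bar>(word_product (H, M) w *v axis 1 1) $ 1\<bar>"
      using good_le[OF good_word[of 1 _ w]] by simp
    also have "\<dots> = norm (word_product (H, M) w $ 1 $ 1)"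
      by (simp add: matrix_vector_mult_basis column_def)
    also have "\<dots> \<le> norm (word_product (H, M) w)"
      by (meson Finite_Cartesian_Product.norm_nth_le order_trans)
    finally show ?thesis .
  qed
  then show ?thesis
    using \<beta>(1) by (intro le_lower_spectral_radius[of "1 / 4"]) auto
qed


text \<open>In the model, \<open>H\<close> is diagonal with entries 4 and 0, and \<open>M\<close>
  has rows (1, -2) and (1, -1), so \<open>det M = 1\<close>. Nearby, the cone bound gives a value of
  at least \<open>\<beta> \<ge> 9 / 10\<close> at the pair, while pairs converging to it have values
  at most \<open>sqrt \<bar>det H\<bar> \<le> 1 / 2\<close>.\<close>

lemma not_isCont_lower_spectral_radius_near_model:
  fixes H M :: "real^2^2"
  assumes H: "\<bar>H $ 1 $ 1 - 4\<bar> \<le> 1 / 100" "\<bar>H $ 1 $ 2\<bar> \<le> 1 / 100"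
      "\<bar>H $ 2 $ 1\<bar> \<le> 1 / 100" "\<bar>H $ 2 $ 2\<bar> \<le> 1 / 100"
    and M: "\<bar>M $ 1 $ 1 - 1\<bar> \<le> 1 / 100" "\<bar>M $ 1 $ 2 + 2\<bar> \<le> 1 / 100" "\<bar>M $ 2 $ 1 - 1\<bar> \<le> 1 / 100"
    and tr: "M $ 2 $ 2 = - (M $ 1 $ 1)"
  shows "\<not> isCont lower_spectral_radius (H, M)"
proof
  assume cont: "isCont lower_spectral_radius (H, M)"
  have mult_bound: "\<bar>x * y\<bar> \<le> a * b" if "\<bar>x\<bar> \<le> a" "\<bar>y\<bar> \<le> b" for x y a b :: real
    unfolding abs_mult using that by (intro mult_mono) auto
  have near: "\<bar>x * s + y * t - (a * s + b * t)\<bar> \<le> 1 / 100 * (\<bar>s\<bar> + \<bar>t\<bar>)"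
    if "\<bar>x - a\<bar> \<le> 1 / 100" "\<bar>y - b\<bar> \<le> 1 / 100" for x y a b s t :: real
  proof -
    have "x * s + y * t - (a * s + b * t) = (x - a) * s + (y - b) * t"
      by (simp add: algebra_simps)
    also have "\<bar>\<dots>\<bar> \<le> \<bar>(x - a) * s\<bar> + \<bar>(y - b) * t\<bar>"
      by (rule abs_triangle_ineq)
    also have "\<dots> \<le> 1 / 100 * \<bar>s\<bar> + 1 / 100 * \<bar>t\<bar>"
      by (intro add_mono mult_bound that order_refl)
    finally show ?thesis by (simp only: distrib_left)
  qed
  define \<beta> where "\<beta> = sqrt (det M)"
  have det_M: "det M = - ((M $ 1 $ 1)\<^sup>2) - M $ 1 $ 2 * M $ 2 $ 1"
    by (simp add: det_2 tr power2_eq_square)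
  have det_bounds: "81 / 100 \<le> det M" "det M \<le> 2"
  proof -
    define x y z where "x = M $ 1 $ 1 - 1" and "y = M $ 1 $ 2 + 2" and "z = M $ 2 $ 1 - 1"
    have xyz: "\<bar>x\<bar> \<le> 1 / 100" "\<bar>y\<bar> \<le> 1 / 100" "\<bar>z\<bar> \<le> 1 / 100"
      using M by (auto simp: x_def y_def z_def)
    \<comment> \<open>Naming the quadratic error terms leaves an expression for \<open>det M\<close>
      that is linear in bounded quantities.\<close>
    define p q where "p = x * x" and "q = y * z"
    have pq: "\<bar>p\<bar> \<le> 1 / 100 * (1 / 100)" "\<bar>q\<bar> \<le> 1 / 100 * (1 / 100)"
      unfolding p_def q_def by (intro mult_bound xyz)+
    have "det M = - p - 2 * x - q - y + 2 * z + 1"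
      by (simp add: det_M x_def y_def z_def p_def q_def power2_eq_square algebra_simps)
    then show "81 / 100 \<le> det M" "det M \<le> 2"
      using pq xyz by linarith+
  qed
  have \<beta>: "9 / 10 \<le> \<beta>" "\<beta>\<^sup>2 = det M"
    using det_bounds real_le_rsqrt[of "9 / 10" "det M"] by (auto simp: \<beta>_def power2_eq_square)
  \<comment> \<open>Cayley-Hamilton for trace 0.\<close>
  have MM: "M ** M = - (\<beta>\<^sup>2 *\<^sub>R mat 1)"
    unfolding \<beta>(2) det_M vec_eq_iff forall_2 matrix_matrix_mult_def
    by (simp add: sum_2 mat_def tr power2_eq_square algebra_simps)
  have "\<beta> \<le> lower_spectral_radius (H, M)"
  proof (rule lower_spectral_radius_ge_if_cone)
    fix v assume "v \<in> horizontal_cone"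
    then have v: "\<bar>v $ 2\<bar> \<le> \<bar>v $ 1\<bar> / 8" by (simp add: horizontal_cone_def)
    have mv: "(A *v w) $ i = A $ i $ 1 * w $ 1 + A $ i $ 2 * w $ 2" for A :: "real^2^2" and w i
      by (simp add: matrix_vector_mult_def sum_2)
    have H_lower: "4 * \<bar>w $ 1\<bar> - 1 / 100 * (\<bar>w $ 1\<bar> + \<bar>w $ 2\<bar>) \<le> \<bar>(H *v w) $ 1\<bar>" for w
    proof -
      have "4 * \<bar>w $ 1\<bar> - \<bar>(H *v w) $ 1\<bar> \<le> \<bar>(H *v w) $ 1 - 4 * w $ 1\<bar>"
        using abs_triangle_ineq2_sym[of "4 * w $ 1" "(H *v w) $ 1"] by (simp add: abs_mult)
      also have "\<dots> \<le> 1 / 100 * (\<bar>w $ 1\<bar> + \<bar>w $ 2\<bar>)"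
        using near[of "H $ 1 $ 1" 4 "H $ 1 $ 2" 0 "w $ 1" "w $ 2"] H by (simp add: mv)
      finally show ?thesis
        by (simp only: diff_le_eq add.commute)
    qed
    have H_upper: "\<bar>(H *v w) $ 2\<bar> \<le> 1 / 100 * (\<bar>w $ 1\<bar> + \<bar>w $ 2\<bar>)" for w
      using near[of "H $ 2 $ 1" 0 "H $ 2 $ 2" 0 "w $ 1" "w $ 2"] H by (simp add: mv)
    have M_near: "\<bar>(M *v v) $ 1 - (v $ 1 - 2 * v $ 2)\<bar> \<le> 1 / 100 * (\<bar>v $ 1\<bar> + \<bar>v $ 2\<bar>)"
      "\<bar>(M *v v) $ 2 - (v $ 1 - v $ 2)\<bar> \<le> 1 / 100 * (\<bar>v $ 1\<bar> + \<bar>v $ 2\<bar>)"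
      using near[of "M $ 1 $ 1" 1 "M $ 1 $ 2" "- 2" "v $ 1" "v $ 2"]
        near[of "M $ 2 $ 1" 1 "M $ 2 $ 2" "- 1" "v $ 1" "v $ 2"] M
      by (simp_all add: mv tr abs_minus_commute)
    have M_lower: "7 / 10 * \<bar>v $ 1\<bar> \<le> \<bar>(M *v v) $ 1\<bar>"
      using M_near(1) v by (auto simp: abs_if field_simps split: if_splits)
    have M_upper: "\<bar>(M *v v) $ 2\<bar> \<le> 14 / 10 * \<bar>v $ 1\<bar>"
      using M_near(2) v by (auto simp: abs_if field_simps split: if_splits)
    \<comment> \<open>Used for \<open>w = v\<close> and \<open>w = M *v v\<close>, with
      \<open>s\<close>, \<open>t\<close> the absolute coordinates of \<open>w\<close>,
      \<open>p\<close>, \<open>q\<close> those of \<open>H *v w\<close>, and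
      \<open>r = \<bar>v $ 1\<bar>\<close>. The condition \<open>t \<le> 2 * s\<close> holds for
      \<open>M *v v\<close> because 14/10 is twice 7/10.\<close>
    have cone: "q \<le> p / 8 \<and> 2 * r \<le> p"
      if "4 * s - 1 / 100 * (s + t) \<le> p" "q \<le> 1 / 100 * (s + t)" "t \<le> 2 * s" "7 / 10 * r \<le> s" "0 \<le> r"
      for p q r s t :: real
      using that by (auto simp: field_simps)
    show "H *v v \<in> horizontal_cone \<and> 2 * \<bar>v $ 1\<bar> \<le> \<bar>(H *v v) $ 1\<bar>"
      unfolding horizontal_cone_def mem_Collect_eq
      by (rule cone[OF H_lower H_upper]) (use v in simp_all)
    show "H *v (M *v v) \<in> horizontal_cone \<and> 2 * \<bar>v $ 1\<bar> \<le> \<bar>(H *v (M *v v)) $ 1\<bar>"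
      unfolding horizontal_cone_def mem_Collect_eq
      by (rule cone[OF H_lower H_upper]) (use M_lower M_upper in simp_all)
    show "\<bar>v $ 1\<bar> / 2 \<le> \<bar>(M *v v) $ 1\<bar>"
      using M_lower by simp
  qed (use \<beta> det_bounds MM in auto)
  define J where "J = (1 / \<beta>) *\<^sub>R M"
  have J: "J ** J = - mat 1" "\<beta> *\<^sub>R J = M"
    using \<beta>(1) by (auto simp: J_def scaleR_matrix_mult_left scaleR_matrix_mult_right MM power2_eq_square)
  have det_H: "\<bar>det H\<bar> \<le> 1 / 4"
    using mult_bound[of "H $ 1 $ 1" "5" "H $ 2 $ 2" "1 / 100"] H
      mult_bound[of "H $ 1 $ 2" "1 / 100" "H $ 2 $ 1" "1 / 100"]
    unfolding det_2 by linarith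
  have tr_H: "3 \<le> trace H"
    using H(1,4) unfolding trace_def sum_2 by linarith
  have "4 * det H < (trace H)\<^sup>2"
    using det_H power_mono[OF tr_H, of 2] by simp
  then obtain X where X: "X \<longlonglongrightarrow> \<beta> *\<^sub>R J" "\<And>m. lower_spectral_radius (H, X m) \<le> sqrt \<bar>det H\<bar>"
    using quarter_turn_perturbation[OF J(1)] tr_H by (metis order_trans zero_le_numeral)
  have "(\<lambda>m. (H, X m)) \<longlonglongrightarrow> (H, M)"
    using X(1) J(2) by (intro tendsto_Pair tendsto_const) simp
  then have "(\<lambda>m. lower_spectral_radius (H, X m)) \<longlonglongrightarrow> lower_spectral_radius (H, M)"
    by (rule isCont_tendsto_compose[OF cont])
  then have "lower_spectral_radius (H, M) \<le> sqrt \<bar>det H\<bar>"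
    using X(2) by (intro LIMSEQ_le_const2) auto
  also have "\<dots> \<le> 1 / 2"
    using det_H real_sqrt_le_mono[OF det_H] by (simp add: real_sqrt_divide)
  finally show False
    using \<open>\<beta> \<le> lower_spectral_radius (H, M)\<close> \<beta>(1) by simp
qed

section \<open>Projecting the trace-zero hyperplane onto seven coordinates\<close>

theorem corollary1p6:
  "hausdorff_dimension {A. \<not> isCont lower_spectral_radius A} \<ge> 7"
proof -
  \<comment> \<open>Forgetting \<open>snd A $ 2 $ 2\<close> is injective on the hyperplane where the
    second trace vanishes, and the target has dimension 4 + 3 = 7.\<close>
  define f :: "mat_pair \<Rightarrow> (real^2^2) \<times> (real^3)"
    where "f = (\<lambda>A. (fst A, vector [snd A $ 1 $ 1, snd A $ 1 $ 2, snd A $ 2 $ 1]))"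
  have "linear f"
    by (rule linearI) (auto simp: f_def vec_eq_iff forall_3)
  then have f: "bounded_linear f"
    by (simp add: linear_conv_bounded_linear)
  define H0 :: "real^2^2" where "H0 = vector [vector [4, 0], vector [0, 0]]"
  define y0 :: "real^3" where "y0 = vector [1, - 2, 1]"
  have "ball H0 (1 / 100) \<times> ball y0 (1 / 100) \<subseteq> f ` {A. \<not> isCont lower_spectral_radius A}"
  proof clarify
    fix H :: "real^2^2" and y :: "real^3"
    assume H: "H \<in> ball H0 (1 / 100)" and y: "y \<in> ball y0 (1 / 100)"
    \<comment> \<open>The trace-zero matrix over \<open>y\<close>, so that \<open>(H, M)\<close> is
      a preimage of \<open>(H, y)\<close> to which the discontinuity lemma applies.\<close>
    define M :: "real^2^2" where "M = vector [vector [y $ 1, y $ 2], vector [y $ 3, - (y $ 1)]]"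
    have H': "\<bar>H $ i $ j - H0 $ i $ j\<bar> \<le> 1 / 100" for i j
    proof -
      have "\<bar>H $ i $ j - H0 $ i $ j\<bar> = norm ((H - H0) $ i $ j)" by simp
      also have "\<dots> \<le> norm (H - H0)"
        by (meson Finite_Cartesian_Product.norm_nth_le order_trans)
      finally show ?thesis using H by (simp add: dist_norm norm_minus_commute)
    qed
    have y': "\<bar>y $ i - y0 $ i\<bar> \<le> 1 / 100" for i
    proof -
      have "\<bar>y $ i - y0 $ i\<bar> \<le> norm (y - y0)"
        using component_le_norm_cart[of "y - y0" i] by simp
      then show ?thesis using y by (simp add: dist_norm norm_minus_commute)
    qed
    have "\<not> isCont lower_spectral_radius (H, M)"
      using H'[of 1 1] H'[of 1 2] H'[of 2 1] H'[of 2 2] y'[of 1] y'[of 2] y'[of 3]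
      by (intro not_isCont_lower_spectral_radius_near_model) (auto simp: H0_def y0_def M_def)
    moreover have "f (H, M) = (H, y)"
      by (simp add: f_def M_def vec_eq_iff forall_3)
    ultimately show "(H, y) \<in> f ` {A. \<not> isCont lower_spectral_radius A}"
      by (metis (mono_tags, lifting) image_eqI mem_Collect_eq)
  qed
  moreover have "open (ball H0 (1 / 100) \<times> ball y0 (1 / 100))"
    by (intro open_Times open_ball)
  ultimately have "ennreal (real DIM((real^2^2) \<times> (real^3))) \<le>
      hausdorff_dimension {A. \<not> isCont lower_spectral_radius A}"
    by (intro hausdorff_dimension_ge_DIM[OF f]) auto
  then show ?thesis by simp
qed

end
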